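(* Let $M$ be a locally finite metric space, with metric $d_M$, which is not coarsely embeddable into $L_1=L_1(0,1)$. Then there exists a constant $D$, depending on $M$ only, such that for each $n\in\mathbb{N}$ there exist a finite set $B_n\subset M\times M$ and a probability measure $\mu$ on $B_n$ such that: (1) $d_M(u,v)\ge n$ for each $(u,v)\in B_n$; (2) for each Lipschitz function $f:M\to L_1$ the inequality $$\int_{B_n}\|f(u)-f(v)\|_{L_1}\,d\mu(u,v)\le D\,\mathrm{Lip}(f)$$ holds.
   Context: A metric space is called locally finite if all balls in it have finitely many elements. A mapping $f:A\to B$ between metric spaces $(A,d_A)$ and $(B,d_B)$ is called a coarse embedding if there exist functions $\rho_1,\rho_2:[0,\infty)\to[0,\infty)$ such that $\rho_1(d_A(x,y))\le d_B(f(x),f(y))\le\rho_2(d_A(x,y))$ for all $x,y\in A$, and $\lim_{r\to\infty}\rho_1(r)=\infty$. A metric space is coarsely embeddable into a Banach space if there exists a coarse embedding of it into that space (with the norm metric). A mapping $f:A\to B$ is Lipschitz if there is a constant $0\le L<\infty$ with $d_B(f(x),f(y))\le L\, d_A(x,y)$ for all $x,y\in A$; $\mathrm{Lip}(f)$ denotes the infimum of all such $L>0$. *)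

theory Defs
  imports "HOL-Probability.Probability"
begin

text \<open>The library has no type of \<open>L\<^sub>1\<close> functions. Here the real space \<open>L\<^sub>1(0,1)\<close> is the quotient of
  the Lebesgue integrable functions on \<open>(0,1)\<close> by almost everywhere equality. Representatives are
  total functions on the reals; their values outside \<open>(0,1)\<close> are irrelevant.\<close>

abbreviation leb01 :: "real measure"
  where "leb01 \<equiv> lebesgue_on {0<..<1}"

quotient_type L1_01 = "real \<Rightarrow> real" / partial:
  "\<lambda>f g. integrable leb01 f \<and> integrable leb01 g \<and> (AE t in leb01. f t = g t)"
proof (rule part_equivpI)
  show "\<exists>f. integrable leb01 f \<and> integrable leb01 f \<and> (AE t in leb01. f t = f t)"
    by (rule exI[of _ "\<lambda>_. 0"]) simp
  show "symp (\<lambda>f g. integrable leb01 f \<and> integrable leb01 g \<and> (AE t in leb01. f t = g t))"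
    by (rule sympI) (auto elim: eventually_mono)
  show "transp (\<lambda>f g. integrable leb01 f \<and> integrable leb01 g \<and> (AE t in leb01. f t = g t))"
    by (rule transpI) (auto elim: eventually_elim2)
qed

instantiation L1_01 :: real_vector
begin

lift_definition zero_L1_01 :: L1_01 is "\<lambda>_. 0"
  by simp

lift_definition plus_L1_01 :: "L1_01 \<Rightarrow> L1_01 \<Rightarrow> L1_01" is "\<lambda>f g t. f t + g t"
  by (auto elim: eventually_elim2)

lift_definition minus_L1_01 :: "L1_01 \<Rightarrow> L1_01 \<Rightarrow> L1_01" is "\<lambda>f g t. f t - g t"
  by (auto elim: eventually_elim2)

lift_definition uminus_L1_01 :: "L1_01 \<Rightarrow> L1_01" is "\<lambda>f t. - f t"
  by (auto elim: eventually_mono)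

lift_definition scaleR_L1_01 :: "real \<Rightarrow> L1_01 \<Rightarrow> L1_01" is "\<lambda>c f t. c * f t"
  by (auto elim: eventually_mono)

instance
  by standard (transfer, auto simp: algebra_simps)+

end

instantiation L1_01 :: real_normed_vector
begin

lift_definition norm_L1_01 :: "L1_01 \<Rightarrow> real" is "\<lambda>f. \<integral>t. \<bar>f t\<bar> \<partial>leb01"
  by (rule integral_cong_AE) (auto elim: eventually_mono)

definition dist_L1_01 :: "L1_01 \<Rightarrow> L1_01 \<Rightarrow> real"
  where "dist_L1_01 f g = norm (f - g)"

definition sgn_L1_01 :: "L1_01 \<Rightarrow> L1_01"
  where "sgn_L1_01 f = inverse (norm f) *\<^sub>R f"

definition uniformity_L1_01 :: "(L1_01 \<times> L1_01) filter"
  where "uniformity_L1_01 = (INF e\<in>{0<..}. principal {(f, g). dist f g < e})"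

definition open_L1_01 :: "L1_01 set \<Rightarrow> bool"
  where "open_L1_01 U \<longleftrightarrow> (\<forall>f\<in>U. \<forall>\<^sub>F (f', g) in uniformity. f' = f \<longrightarrow> g \<in> U)"

instance
proof
  fix f g :: L1_01 and c :: real and U :: "L1_01 set"
  show "dist f g = norm (f - g)"
    by (rule dist_L1_01_def)
  show "sgn f = inverse (norm f) *\<^sub>R f"
    by (rule sgn_L1_01_def)
  show "uniformity = (INF e\<in>{0<..}. principal {(f :: L1_01, g). dist f g < e})"
    by (rule uniformity_L1_01_def)
  show "open U \<longleftrightarrow> (\<forall>f\<in>U. \<forall>\<^sub>F (f', g) in uniformity. f' = f \<longrightarrow> g \<in> U)"
    by (rule open_L1_01_def)
  show "norm f = 0 \<longleftrightarrow> f = 0"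
    by transfer (simp add: integral_nonneg_eq_0_iff_AE)
  show "norm (f + g) \<le> norm f + norm g"
  proof transfer
    fix f g :: "real \<Rightarrow> real"
    assume "integrable leb01 f \<and> integrable leb01 f \<and> (AE t in leb01. f t = f t)"
      and "integrable leb01 g \<and> integrable leb01 g \<and> (AE t in leb01. g t = g t)"
    then have f: "integrable leb01 f" and g: "integrable leb01 g" by auto
    have "(\<integral>t. \<bar>f t + g t\<bar> \<partial>leb01) \<le> (\<integral>t. \<bar>f t\<bar> + \<bar>g t\<bar> \<partial>leb01)"
      using f g by (intro integral_mono) auto
    also have "\<dots> = (\<integral>t. \<bar>f t\<bar> \<partial>leb01) + (\<integral>t. \<bar>g t\<bar> \<partial>leb01)"
      using f g by simp
    finally show "(\<integral>t. \<bar>f t + g t\<bar> \<partial>leb01) \<le> (\<integral>t. \<bar>f t\<bar> \<partial>leb01) + (\<integral>t. \<bar>g t\<bar> \<partial>leb01)" .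
  qed
  show "norm (c *\<^sub>R f) = \<bar>c\<bar> * norm f"
    by transfer (simp add: abs_mult)
qed

end

definition locally_finite_metric :: "'a::metric_space set \<Rightarrow> bool"
  where "locally_finite_metric M \<longleftrightarrow> (\<forall>x\<in>M. \<forall>r. finite (M \<inter> cball x r))"

text \<open>The control functions \<open>\<rho>\<^sub>1\<close> and \<open>\<rho>\<^sub>2\<close> map \<open>[0,\<infinity>)\<close> to itself; their values at negative
  arguments play no role.\<close>

definition coarse_embedding_on ::
    "'a::metric_space set \<Rightarrow> ('a \<Rightarrow> 'b::metric_space) \<Rightarrow> bool"
  where "coarse_embedding_on A f \<longleftrightarrow>
    (\<exists>\<rho>\<^sub>1 \<rho>\<^sub>2 :: real \<Rightarrow> real.
      \<rho>\<^sub>1 \<in> {0..} \<rightarrow> {0..} \<and> \<rho>\<^sub>2 \<in> {0..} \<rightarrow> {0..} \<and>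
      (\<forall>x\<in>A. \<forall>y\<in>A. \<rho>\<^sub>1 (dist x y) \<le> dist (f x) (f y) \<and> dist (f x) (f y) \<le> \<rho>\<^sub>2 (dist x y)) \<and>
      filterlim \<rho>\<^sub>1 at_top at_top)"

definition Lip_const :: "'a::metric_space set \<Rightarrow> ('a \<Rightarrow> 'b::metric_space) \<Rightarrow> real"
  where "Lip_const A f = Inf {L. 0 < L \<and> L-lipschitz_on A f}"

end

theory Submission
  imports Defs
begin

text \<open>The proof is by contraposition: if for every \<open>D\<close> some scale \<open>n\<close> admits no measure, then \<open>M\<close>
  embeds coarsely into \<open>L\<^sub>1\<close>.

  For such \<open>D\<close> and \<open>n\<close>, and a finite set \<open>B\<close> of pairs at distance at least \<open>n\<close>, every choice of
  probability weights on \<open>B\<close> comes with a \<open>1\<close>-Lipschitz map into \<open>L\<^sub>1\<close> whose weighted average expansion on \<open>B\<close> is at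
  least \<open>D\<close> (\<open>average_expansion\<close>). The map depends on the weights, but the vectors
  of distances \<open>norm (f u - f v)\<close>, for \<open>(u, v)\<close> in \<open>B\<close>, form a bounded convex set
  (\<open>lipschitz_L1_convex\<close>). A minimax argument (\<open>minimax_convex_family\<close>) therefore yields a single \<open>1\<close>-Lipschitz
  map that expands every pair of \<open>B\<close> to nearly \<open>D\<close> (\<open>expansion_on_finite_set\<close>).

  Balls in \<open>M\<close> are finite, so \<open>B\<close> may consist of all sufficiently distant pairs in a ball. The maps obtained
  for balls of growing radius are glued to one Lipschitz map on \<open>M\<close> that expands all pairs
  at distance at least \<open>n\<close> to a fixed fraction of \<open>D\<close>, with a Lipschitz constant that does not depend
  on \<open>D\<close> (\<open>barycentric_gluing\<close>). Letting \<open>D\<close> run through a sequence that tends to infinity and adding the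
  resulting maps with geometric weights gives a coarse embedding
  (\<open>coarse_embedding_of_expansions\<close>).

  Convex combinations, gluing and the final sum all take place in an \<open>\<ell>\<^sub>1\<close>-sum of copies of \<open>L\<^sub>1\<close>,
  and \<open>l1_sum_in_L1\<close> brings them back to \<open>L\<^sub>1\<close>.\<close>

section \<open>Countable sums inside \<open>L\<^sub>1(0,1)\<close>\<close>

text \<open>Every class is represented by a function that vanishes off \<open>(0,1)\<close>. This normalisation turns
  norms into integrals over the whole line, where an affine change of variable needs no bookkeeping
  of domains.\<close>

definition represents :: "(real \<Rightarrow> real) \<Rightarrow> L1_01 \<Rightarrow> bool"
  where "represents r h \<longleftrightarrow>
    integrable lebesgue r \<and> (\<forall>t. t \<notin> {0<..<1} \<longrightarrow> r t = 0) \<and> h = abs_L1_01 r"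

lemma zero_extension_integrable:
  fixes r :: "real \<Rightarrow> real"
  assumes "\<forall>t. t \<notin> {0<..<1} \<longrightarrow> r t = 0"
  shows "integrable leb01 r \<longleftrightarrow> integrable lebesgue r"
    and "integral\<^sup>L leb01 r = integral\<^sup>L lebesgue r"
proof -
  have *: "(\<lambda>t. indicator {0<..<1} t *\<^sub>R r t) = r"
    using assms by (auto simp: indicator_def fun_eq_iff)
  show "integrable leb01 r \<longleftrightarrow> integrable lebesgue r"
    by (subst integrable_restrict_space) (simp_all only: *, simp_all)
  show "integral\<^sup>L leb01 r = integral\<^sup>L lebesgue r"
    by (subst integral_restrict_space) (simp_all only: *, simp_all)
qed

lemma represents_exists: "\<exists>r. represents r h"
proof (induct h rule: L1_01.abs_induct)
  case (1 f)
  define r where "r = (\<lambda>t. indicator {0<..<1} t *\<^sub>R f t)"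
  have r0: "\<forall>t. t \<notin> {0<..<1} \<longrightarrow> r t = 0"
    by (simp add: r_def)
  have int: "integrable lebesgue r"
    using 1 unfolding r_def by (subst (asm) integrable_restrict_space) auto
  have "AE t in leb01. f t = r t"
    by (rule AE_I2) (simp add: r_def)
  then have "abs_L1_01 f = abs_L1_01 r"
    using 1 int zero_extension_integrable(1)[OF r0]
    by (intro Quotient_rel_abs[OF Quotient_L1_01]) auto
  with r0 int show ?case
    unfolding represents_def by blast
qed

lemma represents_dist:
  assumes "represents r h" "represents r' h'"
  shows "ennreal (norm (h - h')) = (\<integral>\<^sup>+t. ennreal \<bar>r t - r' t\<bar> \<partial>lebesgue)"
proof -
  have int: "integrable lebesgue r" "integrable lebesgue r'"
    and leb01: "integrable leb01 r" "integrable leb01 r'"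
    and z: "\<forall>t. t \<notin> {0<..<1} \<longrightarrow> \<bar>r t - r' t\<bar> = 0"
    and h: "h = abs_L1_01 r" "h' = abs_L1_01 r'"
    using assms zero_extension_integrable(1) unfolding represents_def by auto
  have "norm (h - h') = (\<integral>t. \<bar>r t - r' t\<bar> \<partial>leb01)"
    using leb01 unfolding h by (simp add: minus_L1_01.abs_eq norm_L1_01.abs_eq)
  also have "\<dots> = (\<integral>t. \<bar>r t - r' t\<bar> \<partial>lebesgue)"
    by (rule zero_extension_integrable(2)[OF z])
  finally show ?thesis
    using int by (simp add: nn_integral_eq_integral)
qed

text \<open>The isometric copy of \<open>r\<close> carried by the dyadic interval between \<open>1 / 2 ^ Suc k\<close> and
  \<open>1 / 2 ^ k\<close>. These intervals are disjoint and lie in \<open>(0,1)\<close>.\<close>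

definition squeeze :: "nat \<Rightarrow> (real \<Rightarrow> real) \<Rightarrow> real \<Rightarrow> real"
  where "squeeze k r t = 2 ^ Suc k * r (-1 + 2 ^ Suc k * t)"

lemma squeeze_measurable:
  assumes "r \<in> borel_measurable lebesgue"
  shows "squeeze k r \<in> borel_measurable lebesgue"
proof -
  have "(\<lambda>t::real. -1 + 2 ^ Suc k * t) \<in> lebesgue \<rightarrow>\<^sub>M lebesgue"
    using lebesgue_affine_measurable[where c="\<lambda>x::real. 2 ^ Suc k" and t="-1"]
    by simp
  from measurable_compose[OF this assms] show ?thesis
    unfolding squeeze_def by simp
qed

lemma squeeze_nn_integral:
  assumes [measurable]: "r \<in> borel_measurable lebesgue" "r' \<in> borel_measurable lebesgue"
  shows "(\<integral>\<^sup>+t. ennreal \<bar>squeeze k r t - squeeze k r' t\<bar> \<partial>lebesgue) =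
    (\<integral>\<^sup>+t. ennreal \<bar>r t - r' t\<bar> \<partial>lebesgue)"
proof -
  have eq: "squeeze k r t - squeeze k r' t = squeeze k (\<lambda>t. r t - r' t) t" for t
    by (simp add: squeeze_def algebra_simps)
  have m: "(\<lambda>t. ennreal \<bar>r t - r' t\<bar>) \<in> borel_measurable lebesgue"
    by measurable
  have m2: "(\<lambda>t. ennreal \<bar>r (-1 + 2 ^ Suc k * t) - r' (-1 + 2 ^ Suc k * t)\<bar>) \<in> borel_measurable lebesgue"
    using squeeze_measurable[of "\<lambda>t. (r t - r' t) / 2 ^ Suc k" k] unfolding squeeze_def by simp
  have "(\<integral>\<^sup>+t. ennreal \<bar>r t - r' t\<bar> \<partial>lebesgue) =
      ennreal (2 ^ Suc k) * (\<integral>\<^sup>+t. ennreal \<bar>r (-1 + 2 ^ Suc k * t) - r' (-1 + 2 ^ Suc k * t)\<bar> \<partial>lebesgue)"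
    using nn_integral_real_affine_lebesgue[OF m, of "2 ^ Suc k" "-1"] by simp
  also have "\<dots> = (\<integral>\<^sup>+t. ennreal (2 ^ Suc k) *
      ennreal \<bar>r (-1 + 2 ^ Suc k * t) - r' (-1 + 2 ^ Suc k * t)\<bar> \<partial>lebesgue)"
    by (rule nn_integral_cmult[OF m2, symmetric])
  also have "\<dots> = (\<integral>\<^sup>+t. ennreal \<bar>squeeze k r t - squeeze k r' t\<bar> \<partial>lebesgue)"
    by (simp add: squeeze_def abs_mult ennreal_mult flip: right_diff_distrib del: power_Suc)
  finally show ?thesis by simp
qed

text \<open>If \<open>j < k\<close>, then \<open>1 < 2 ^ Suc j * t\<close> forces \<open>2 < 2 ^ Suc k * t\<close>, so no point \<open>t\<close> lies in both
  dyadic intervals.\<close>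

lemma squeeze_disjoint:
  assumes "\<forall>s. s \<notin> {0<..<1} \<longrightarrow> r s = 0" "\<forall>s. s \<notin> {0<..<1} \<longrightarrow> r' s = 0"
    and "squeeze j r t \<noteq> 0" "squeeze k r' t \<noteq> 0"
  shows "j = k"
proof -
  have in01: "0 < -1 + 2 ^ Suc j * t" "-1 + 2 ^ Suc j * t < 1" "0 < -1 + 2 ^ Suc k * t" "-1 + 2 ^ Suc k * t < 1"
    using assms unfolding squeeze_def by (metis greaterThanLessThan_iff mult_zero_right)+
  have t: "0 < t"
    using in01(1) by (smt (verit) mult_nonneg_nonpos zero_le_power)
  have no: False if "a < b" "1 < 2 ^ Suc a * t" "2 ^ Suc b * t < 2" for a b :: nat
  proof -
    have "2 * 2 ^ Suc a \<le> (2 ^ Suc b :: real)"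
      using power_increasing[of "Suc (Suc a)" "Suc b" "2::real"] that(1) by simp
    then have "(2 * 2 ^ Suc a) * t \<le> 2 ^ Suc b * t"
      using t by (intro mult_right_mono) auto
    with that(2,3) show False by linarith
  qed
  show ?thesis
    using no[of j k] no[of k j] in01 by (cases j k rule: linorder_cases) auto
qed

lemma squeeze_outside:
  assumes "\<forall>s. s \<notin> {0<..<1} \<longrightarrow> r s = 0" "t \<notin> {0<..<1}"
  shows "squeeze k r t = 0"
proof (rule ccontr)
  assume "squeeze k r t \<noteq> 0"
  then have *: "0 < -1 + 2 ^ Suc k * t" "-1 + 2 ^ Suc k * t < 1"
    using assms(1) unfolding squeeze_def by (metis greaterThanLessThan_iff mult_zero_right)+
  have "0 < t"
    using *(1) by (smt (verit) mult_nonneg_nonpos zero_le_power)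
  moreover from this have "2 * t \<le> 2 ^ Suc k * t"
    by (intro mult_right_mono) auto
  moreover have "1 \<le> t"
    using \<open>0 < t\<close> assms(2) by auto
  ultimately show False
    using *(2) by linarith
qed


text \<open>At each point at most one summand survives, so the absolute value passes inside the sum, and
  monotone convergence exchanges sum and integral.\<close>

lemma squeeze_sum_represents:
  assumes r: "\<And>k. represents (r k) (h k)" and r': "\<And>k. represents (r' k) (h' k)"
    and summ: "summable (\<lambda>k. norm (h k - h' k))"
  shows "(\<integral>\<^sup>+t. ennreal \<bar>(\<Sum>k. squeeze k (r k) t) - (\<Sum>k. squeeze k (r' k) t)\<bar> \<partial>lebesgue) =
    ennreal (\<Sum>k. norm (h k - h' k))"
proof -
  have m [measurable]: "r k \<in> borel_measurable lebesgue" "r' k \<in> borel_measurable lebesgue" for k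
    using r[of k] r'[of k] unfolding represents_def by auto
  note [measurable] = squeeze_measurable[OF m(1)] squeeze_measurable[OF m(2)]
  have z: "\<forall>s. s \<notin> {0<..<1} \<longrightarrow> r k s = 0" "\<forall>s. s \<notin> {0<..<1} \<longrightarrow> r' k s = 0" for k
    using r[of k] r'[of k] unfolding represents_def by auto
  have pointwise: "ennreal \<bar>(\<Sum>k. squeeze k (r k) t) - (\<Sum>k. squeeze k (r' k) t)\<bar> =
      (\<Sum>k. ennreal \<bar>squeeze k (r k) t - squeeze k (r' k) t\<bar>)" for t
  proof -
    obtain j where j: "\<And>k. k \<noteq> j \<Longrightarrow> squeeze k (r k) t = 0 \<and> squeeze k (r' k) t = 0"
    proof (cases "\<exists>j. squeeze j (r j) t \<noteq> 0 \<or> squeeze j (r' j) t \<noteq> 0")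
      case True
      then obtain i where i: "squeeze i (r i) t \<noteq> 0 \<or> squeeze i (r' i) t \<noteq> 0" by blast
      then have "squeeze k (r k) t = 0 \<and> squeeze k (r' k) t = 0" if "k \<noteq> i" for k
        using squeeze_disjoint[of "r i" "r k" i t k] squeeze_disjoint[of "r i" "r' k" i t k]
          squeeze_disjoint[of "r' i" "r k" i t k] squeeze_disjoint[of "r' i" "r' k" i t k] z that
        by blast
      with that show thesis by blast
    next
      case False
      with that show thesis by blast
    qed
    have "(\<Sum>k. squeeze k (r k) t) = squeeze j (r j) t" "(\<Sum>k. squeeze k (r' k) t) = squeeze j (r' j) t"
      "(\<Sum>k. ennreal \<bar>squeeze k (r k) t - squeeze k (r' k) t\<bar>) = ennreal \<bar>squeeze j (r j) t - squeeze j (r' j) t\<bar>"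
      by (subst suminf_finite[of "{j}"]; use j in simp)+
    then show ?thesis by simp
  qed
  have "(\<integral>\<^sup>+t. (\<Sum>k. ennreal \<bar>squeeze k (r k) t - squeeze k (r' k) t\<bar>) \<partial>lebesgue) =
      (\<Sum>k. \<integral>\<^sup>+t. ennreal \<bar>squeeze k (r k) t - squeeze k (r' k) t\<bar> \<partial>lebesgue)"
    by (rule nn_integral_suminf) measurable
  also have "\<dots> = (\<Sum>k. ennreal (norm (h k - h' k)))"
    by (simp add: squeeze_nn_integral represents_dist[OF r r'])
  also have "\<dots> = ennreal (\<Sum>k. norm (h k - h' k))"
    using summ by (intro suminf_ennreal2) auto
  finally show ?thesis by (simp add: pointwise)
qed

text \<open>The space \<open>L\<^sub>1(0,1)\<close> contains an isometric copy of the \<open>\<ell>\<^sub>1\<close>-sum of countably many copies of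
  itself, one on each dyadic interval. The maps \<open>f k\<close> are first translated to vanish at a base
  point \<open>b\<close>: only differences are assumed summable, and after the translation each point itself
  is mapped to a summable sequence. This is the only property of \<open>L\<^sub>1\<close>, besides being nonzero, that the
  constructions below rely on.\<close>

lemma l1_sum_in_L1:
  fixes f :: "nat \<Rightarrow> 'a \<Rightarrow> L1_01"
  assumes summ: "\<And>x y. x \<in> A \<Longrightarrow> y \<in> A \<Longrightarrow> summable (\<lambda>k. norm (f k x - f k y))"
  shows "\<exists>g :: 'a \<Rightarrow> L1_01. \<forall>x\<in>A. \<forall>y\<in>A. norm (g x - g y) = (\<Sum>k. norm (f k x - f k y))"
proof (cases "A = {}")
  case True
  then show ?thesis by blast
next
  case False
  then obtain b where b: "b \<in> A" by blast
  define h where "h = (\<lambda>x k. f k x - f k b)"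
  define r where "r = (\<lambda>x k. SOME r. represents r (h x k))"
  have r: "represents (r x k) (h x k)" for x k
    unfolding r_def using someI_ex[OF represents_exists[of "h x k"]] by simp
  define s where "s = (\<lambda>x t. \<Sum>k. squeeze k (r x k) t)"
  have s_dist: "(\<integral>\<^sup>+t. ennreal \<bar>s x t - s y t\<bar> \<partial>lebesgue) = ennreal (\<Sum>k. norm (f k x - f k y))"
    if "x \<in> A" "y \<in> A" for x y
    using squeeze_sum_represents[of "r x" "h x" "r y" "h y", OF r r] summ[OF that]
    by (simp add: s_def h_def)
  have s_represents: "represents (s x) (abs_L1_01 (s x))" if x: "x \<in> A" for x
    unfolding represents_def
  proof (intro conjI allI impI)
    have [measurable]: "squeeze k (r x k) \<in> borel_measurable lebesgue" for k
      using r[of x k] by (intro squeeze_measurable) (auto simp: represents_def)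
    have [measurable]: "s x \<in> borel_measurable lebesgue"
      unfolding s_def by measurable
    have zero: "represents (\<lambda>t. 0) (0::L1_01)"
      by (simp add: represents_def zero_L1_01.abs_eq)
    have "(\<integral>\<^sup>+t. ennreal \<bar>s x t - (\<Sum>k. squeeze k (\<lambda>t. 0) t)\<bar> \<partial>lebesgue) =
        ennreal (\<Sum>k. norm (f k x - f k b))"
      using squeeze_sum_represents[of "r x" "h x" "\<lambda>k t. 0" "\<lambda>k. 0", OF r zero] summ[OF x b]
      by (simp add: s_def h_def)
    then have "(\<integral>\<^sup>+t. ennreal \<bar>s x t\<bar> \<partial>lebesgue) < \<infinity>"
      by (simp add: squeeze_def)
    then show "integrable lebesgue (s x)"
      by (simp add: integrable_iff_bounded)
    show "s x t = 0" if "t \<notin> {0<..<1}" for t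
    proof -
      have "squeeze k (r x k) t = 0" for k
        using r[of x k] that by (intro squeeze_outside) (auto simp: represents_def)
      then show ?thesis by (simp add: s_def)
    qed
  qed simp
  show ?thesis
  proof (rule exI[of _ "\<lambda>x. abs_L1_01 (s x)"], intro ballI)
    fix x y assume xy: "x \<in> A" "y \<in> A"
    have "ennreal (norm (abs_L1_01 (s x) - abs_L1_01 (s y))) = ennreal (\<Sum>k. norm (f k x - f k y))"
      using represents_dist[OF s_represents s_represents] s_dist xy by simp
    then show "norm (abs_L1_01 (s x) - abs_L1_01 (s y)) = (\<Sum>k. norm (f k x - f k y))"
      using summ[OF xy] by (simp add: suminf_nonneg)
  qed
qed

section \<open>From average expansion to expansion at every pair\<close>

text \<open>A minimax principle, proved by descent instead of separation. The penalty \<open>\<phi> x\<close> is the squared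
  distance from \<open>x\<close> to the orthant of points with all coordinates at least \<open>c\<close>. If its infimum \<open>m\<close>
  over \<open>K\<close> were positive, take \<open>x\<close> that nearly attains it and use the shortfalls \<open>p x\<close> of \<open>x\<close>, normalised,
  as weights. A point \<open>y\<close> of \<open>K\<close> whose weighted average is at least \<open>c\<close> lies in a direction in which \<open>\<phi>\<close>
  decreases at rate at least \<open>2 * \<phi> x\<close>, so that a step from \<open>x\<close> towards \<open>y\<close> goes below \<open>m\<close>. As the infimum need
  not be attained, \<open>c\<close> is reached only up to an arbitrarily small error \<open>e\<close>.\<close>

lemma minimax_convex_family:
  fixes K :: "('i \<Rightarrow> real) set"
  assumes "finite I" and "K \<noteq> {}"
    and convex: "\<And>x y t. x \<in> K \<Longrightarrow> y \<in> K \<Longrightarrow> 0 \<le> t \<Longrightarrow> t \<le> 1 \<Longrightarrow>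
      \<exists>z\<in>K. \<forall>i\<in>I. z i = (1 - t) * x i + t * y i"
    and bounded: "\<And>x i. x \<in> K \<Longrightarrow> i \<in> I \<Longrightarrow> \<bar>x i\<bar> \<le> R"
    and average: "\<And>a. (\<forall>i\<in>I. 0 \<le> a i) \<Longrightarrow> sum a I = 1 \<Longrightarrow> \<exists>x\<in>K. c \<le> (\<Sum>i\<in>I. a i * x i)"
    and "0 < e"
  shows "\<exists>x\<in>K. \<forall>i\<in>I. c - e \<le> x i"
proof (rule ccontr)
  assume neg: "\<not> ?thesis"
  define p where "p = (\<lambda>(x :: 'i \<Rightarrow> real) i. max 0 (c - x i))"
  define \<phi> where "\<phi> = (\<lambda>x. \<Sum>i\<in>I. (p x i)\<^sup>2)"
  have \<phi>_large: "e\<^sup>2 \<le> \<phi> x" if x: "x \<in> K" for x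
  proof -
    obtain i where i: "i \<in> I" "x i < c - e"
      using neg x by (meson not_le)
    have "e \<le> p x i"
      using i by (simp add: p_def)
    then have "e\<^sup>2 \<le> (p x i)\<^sup>2"
      using \<open>0 < e\<close> by (simp add: power_mono)
    also have "\<dots> \<le> \<phi> x"
      unfolding \<phi>_def using i \<open>finite I\<close> by (intro member_le_sum) auto
    finally show ?thesis .
  qed
  define m where "m = (INF x\<in>K. \<phi> x)"
  have bdd: "bdd_below (\<phi> ` K)"
    using \<phi>_large by (intro bdd_belowI2)
  have m_le: "m \<le> \<phi> x" if "x \<in> K" for x
    unfolding m_def using bdd that by (rule cINF_lower)
  have "e\<^sup>2 \<le> m"
    unfolding m_def using \<open>K \<noteq> {}\<close> \<phi>_large by (intro cINF_greatest)
  then have "0 < m"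
    using \<open>0 < e\<close> by (smt (verit) zero_less_power)
  define C where "C = (\<Sum>i\<in>I. (2 * R)\<^sup>2)"
  have "0 \<le> C"
    unfolding C_def by (intro sum_nonneg) auto
  \<comment> \<open>The step is so short that the quadratic error \<open>t\<^sup>2 * C\<close> costs at most half of the first-order
    gain \<open>2 * t * m\<close>.\<close>
  define t where "t = m / (C + m)"
  have t: "0 < t" "t \<le> 1" "t * C \<le> m"
    using \<open>0 < m\<close> \<open>0 \<le> C\<close> by (auto simp: t_def field_simps)
  obtain x where x: "x \<in> K" "\<phi> x < m + t * m"
    using cINF_less_iff[OF \<open>K \<noteq> {}\<close> bdd, of "m + t * m"] \<open>0 < m\<close> t unfolding m_def by auto
  define S where "S = sum (p x) I"
  have p_nonneg: "0 \<le> p x i" for i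
    by (simp add: p_def)
  have "S \<noteq> 0"
  proof
    assume "S = 0"
    then have "\<forall>i\<in>I. p x i = 0"
      unfolding S_def using \<open>finite I\<close> p_nonneg by (simp add: sum_nonneg_eq_0_iff)
    then have "\<phi> x = 0"
      by (simp add: \<phi>_def)
    with m_le[OF x(1)] \<open>0 < m\<close> show False by simp
  qed
  moreover have "0 \<le> S"
    unfolding S_def using p_nonneg by (intro sum_nonneg) auto
  ultimately have "0 < S" by simp
  have "\<exists>y\<in>K. c \<le> (\<Sum>i\<in>I. (p x i / S) * y i)"
    using \<open>0 < S\<close> p_nonneg by (intro average) (auto simp: S_def simp flip: sum_divide_distrib)
  then obtain y where y: "y \<in> K" "c \<le> (\<Sum>i\<in>I. (p x i / S) * y i)" by blast
  have "(\<Sum>i\<in>I. (p x i / S) * y i) = (\<Sum>i\<in>I. p x i * y i) / S"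
    by (simp add: sum_divide_distrib)
  then have "c * S \<le> (\<Sum>i\<in>I. p x i * y i)"
    using y(2) \<open>0 < S\<close> by (simp add: pos_le_divide_eq)
  moreover have "\<phi> x = c * S - (\<Sum>i\<in>I. p x i * x i)"
    unfolding \<phi>_def S_def sum_distrib_left sum_subtractf[symmetric]
  proof (rule sum.cong)
    fix i
    have "p x i * p x i = p x i * (c - x i)"
      by (simp add: p_def max_def)
    then show "(p x i)\<^sup>2 = c * p x i - p x i * x i"
      by (simp add: power2_eq_square right_diff_distrib mult.commute)
  qed simp
  ultimately have descent: "\<phi> x \<le> (\<Sum>i\<in>I. p x i * (y i - x i))"
    by (simp add: right_diff_distrib sum_subtractf)
  obtain z where z: "z \<in> K" "\<And>i. i \<in> I \<Longrightarrow> z i = (1 - t) * x i + t * y i"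
    using convex[OF x(1) y(1), of t] t by auto
  have "\<phi> z \<le> (\<Sum>i\<in>I. (p x i)\<^sup>2 - 2 * t * (p x i * (y i - x i)) + t\<^sup>2 * (2 * R)\<^sup>2)"
    unfolding \<phi>_def
  proof (rule sum_mono)
    fix i assume i: "i \<in> I"
    have zi: "c - z i = (c - x i) - t * (y i - x i)"
      using z(2)[OF i] by (simp add: algebra_simps)
    have "\<bar>p z i\<bar> \<le> \<bar>p x i - t * (y i - x i)\<bar>"
      unfolding p_def zi by (auto simp: max_def)
    then have "(p z i)\<^sup>2 \<le> (p x i - t * (y i - x i))\<^sup>2"
      by (simp add: abs_le_square_iff)
    also have "\<dots> = (p x i)\<^sup>2 - 2 * t * (p x i * (y i - x i)) + t\<^sup>2 * (y i - x i)\<^sup>2"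
      by (simp add: power2_eq_square algebra_simps)
    also have "\<dots> \<le> (p x i)\<^sup>2 - 2 * t * (p x i * (y i - x i)) + t\<^sup>2 * (2 * R)\<^sup>2"
    proof -
      have "\<bar>y i - x i\<bar> \<le> 2 * R"
        using bounded[OF x(1) i] bounded[OF y(1) i] by linarith
      then have "(y i - x i)\<^sup>2 \<le> (2 * R)\<^sup>2"
        using abs_le_square_iff[of "y i - x i" "2 * R"] by linarith
      then show ?thesis
        using mult_left_mono[of "(y i - x i)\<^sup>2" "(2 * R)\<^sup>2" "t\<^sup>2"] by simp
    qed
    finally show "(p z i)\<^sup>2 \<le> (p x i)\<^sup>2 - 2 * t * (p x i * (y i - x i)) + t\<^sup>2 * (2 * R)\<^sup>2" .
  qed
  also have "\<dots> = \<phi> x - 2 * t * (\<Sum>i\<in>I. p x i * (y i - x i)) + t * (t * C)"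
    unfolding \<phi>_def C_def
    by (simp only: sum.distrib sum_subtractf sum_distrib_left power2_eq_square mult.assoc)
  also have "\<dots> \<le> \<phi> x - 2 * t * m + t * m"
  proof -
    have "2 * t * m \<le> 2 * t * (\<Sum>i\<in>I. p x i * (y i - x i))"
      using descent m_le[OF x(1)] t by (intro mult_left_mono) auto
    moreover have "t * (t * C) \<le> t * m"
      using t by (intro mult_left_mono) auto
    ultimately show ?thesis by linarith
  qed
  also have "\<dots> < m"
    using x(2) by (simp add: algebra_simps)
  finally show False
    using m_le[OF z(1)] by simp
qed

text \<open>The semimetrics induced by \<open>1\<close>-Lipschitz maps into \<open>L\<^sub>1\<close> form a convex set, as the combination is
  induced by the \<open>\<ell>\<^sub>1\<close>-sum of the two scaled maps. For maps into a Hilbert space this fails; here it makes the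
  minimax principle applicable.\<close>

lemma lipschitz_L1_convex:
  fixes f g :: "'a::metric_space \<Rightarrow> L1_01"
  assumes f: "1-lipschitz_on M f" and g: "1-lipschitz_on M g" and t: "0 \<le> t" "t \<le> 1"
  shows "\<exists>h :: 'a \<Rightarrow> L1_01. 1-lipschitz_on M h \<and>
    (\<forall>u\<in>M. \<forall>v\<in>M. norm (h u - h v) = (1 - t) * norm (f u - f v) + t * norm (g u - g v))"
proof -
  define F where "F = (\<lambda>(k::nat) x. if k = 0 then (1 - t) *\<^sub>R f x else if k = 1 then t *\<^sub>R g x else 0)"
  have sums: "(\<lambda>k. norm (F k u - F k v)) sums ((1 - t) * norm (f u - f v) + t * norm (g u - g v))" for u v
    using sums_finite[of "{0, 1::nat}" "\<lambda>k. norm (F k u - F k v)"] t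
    by (simp add: F_def flip: scaleR_diff_right)
  have "\<exists>h :: 'a \<Rightarrow> L1_01. \<forall>u\<in>M. \<forall>v\<in>M. norm (h u - h v) = (\<Sum>k. norm (F k u - F k v))"
    by (rule l1_sum_in_L1) (rule sums_summable[OF sums])
  then obtain h :: "'a \<Rightarrow> L1_01" where h: "\<forall>u\<in>M. \<forall>v\<in>M. norm (h u - h v) = (\<Sum>k. norm (F k u - F k v))" ..
  have h': "norm (h u - h v) = (1 - t) * norm (f u - f v) + t * norm (g u - g v)"
    if "u \<in> M" "v \<in> M" for u v
    using h that by (simp add: sums_unique[OF sums])
  have "1-lipschitz_on M h"
  proof (rule lipschitz_onI)
    fix u v assume uv: "u \<in> M" "v \<in> M"
    have "(1 - t) * norm (f u - f v) + t * norm (g u - g v) \<le> (1 - t) * dist u v + t * dist u v"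
      using lipschitz_onD[OF f uv] lipschitz_onD[OF g uv] t
      by (intro add_mono mult_left_mono) (auto simp: dist_norm)
    then show "dist (h u) (h v) \<le> 1 * dist u v"
      using h'[OF uv] by (simp add: dist_norm algebra_simps)
  qed simp
  with h' show ?thesis by blast
qed

lemma expansion_on_finite_set:
  fixes M :: "'a::metric_space set"
  assumes B: "finite B" "B \<subseteq> M \<times> M"
    and average: "\<And>a. (\<forall>p\<in>B. 0 \<le> a p) \<Longrightarrow> sum a B = 1 \<Longrightarrow>
      \<exists>f :: 'a \<Rightarrow> L1_01. 1-lipschitz_on M f \<and> c \<le> (\<Sum>p\<in>B. a p * norm (f (fst p) - f (snd p)))"
    and "0 < e"
  shows "\<exists>f :: 'a \<Rightarrow> L1_01. 1-lipschitz_on M f \<and> (\<forall>(u, v)\<in>B. c - e \<le> norm (f u - f v))"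
proof -
  define K where "K = {\<lambda>p. norm (f (fst p) - f (snd p)) | f :: 'a \<Rightarrow> L1_01. 1-lipschitz_on M f}"
  have "\<exists>x\<in>K. \<forall>p\<in>B. c - e \<le> x p"
  proof (rule minimax_convex_family[OF \<open>finite B\<close> _ _ _ _ \<open>0 < e\<close>])
    have "1-lipschitz_on M (\<lambda>_. 0 :: L1_01)"
      by (rule lipschitz_onI) auto
    then show "K \<noteq> {}"
      unfolding K_def by blast
  next
    fix x y t assume "x \<in> K" "y \<in> K" and t: "0 \<le> t" "t \<le> (1::real)"
    then obtain f g :: "'a \<Rightarrow> L1_01" where f: "1-lipschitz_on M f" "x = (\<lambda>p. norm (f (fst p) - f (snd p)))"
      and g: "1-lipschitz_on M g" "y = (\<lambda>p. norm (g (fst p) - g (snd p)))"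
      unfolding K_def by blast
    obtain h :: "'a \<Rightarrow> L1_01" where h: "1-lipschitz_on M h" "\<And>u v. u \<in> M \<Longrightarrow> v \<in> M \<Longrightarrow>
      norm (h u - h v) = (1 - t) * norm (f u - f v) + t * norm (g u - g v)"
      using lipschitz_L1_convex[OF f(1) g(1) t] by blast
    show "\<exists>z\<in>K. \<forall>p\<in>B. z p = (1 - t) * x p + t * y p"
    proof (rule bexI, rule ballI)
      show "(\<lambda>p. norm (h (fst p) - h (snd p))) \<in> K"
        unfolding K_def using h(1) by blast
      show "norm (h (fst p) - h (snd p)) = (1 - t) * x p + t * y p" if "p \<in> B" for p
        using h(2)[of "fst p" "snd p"] that B(2) unfolding f(2) g(2) by auto
    qed
  next
    fix x p assume "x \<in> K" and p: "p \<in> B"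
    then obtain f :: "'a \<Rightarrow> L1_01" where f: "1-lipschitz_on M f" "x = (\<lambda>p. norm (f (fst p) - f (snd p)))"
      unfolding K_def by blast
    have "\<bar>x p\<bar> \<le> dist (fst p) (snd p)"
      using lipschitz_onD[OF f(1), of "fst p" "snd p"] p B(2) unfolding f(2) by (auto simp: dist_norm)
    also have "\<dots> \<le> (\<Sum>p\<in>B. dist (fst p) (snd p))"
      using p B(1) by (intro member_le_sum) auto
    finally show "\<bar>x p\<bar> \<le> (\<Sum>p\<in>B. dist (fst p) (snd p))" .
  next
    fix a :: "'a \<times> 'a \<Rightarrow> real" assume "\<forall>p\<in>B. 0 \<le> a p" "sum a B = 1"
    from average[OF this] obtain f :: "'a \<Rightarrow> L1_01"
      where f: "1-lipschitz_on M f" "c \<le> (\<Sum>p\<in>B. a p * norm (f (fst p) - f (snd p)))"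
      by blast
    show "\<exists>x\<in>K. c \<le> (\<Sum>p\<in>B. a p * x p)"
      by (rule bexI[of _ "\<lambda>p. norm (f (fst p) - f (snd p))"]) (use f in \<open>auto simp: K_def\<close>)
  qed
  then obtain f :: "'a \<Rightarrow> L1_01" where f: "1-lipschitz_on M f"
      "\<forall>p\<in>B. c - e \<le> norm (f (fst p) - f (snd p))"
    unfolding K_def by blast
  then show ?thesis
    by (auto simp: case_prod_beta)
qed

section \<open>Gluing maps that expand on balls\<close>

lemma L1_unit_vector: "\<exists>e :: L1_01. norm e = 1"
proof -
  have "norm (abs_L1_01 (\<lambda>_. 1)) = 1"
    by (subst norm_L1_01.abs_eq) (auto simp: integrable_restrict_space measure_restrict_space)
  then show ?thesis ..
qed

lemma log_scale_slope:
  assumes "0 \<le> s" "s \<le> (r::real)"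
  shows "\<bar>ln (1 + r) - ln (1 + s)\<bar> * s \<le> r - s"
proof -
  have "ln (1 + s) \<le> ln (1 + r)"
    using assms by simp
  moreover have "ln (1 + r) - ln (1 + s) \<le> (r - s) / (1 + s)"
    using assms ln_diff_le[of "1 + r" "1 + s"] by simp
  ultimately have "\<bar>ln (1 + r) - ln (1 + s)\<bar> * s \<le> (r - s) / (1 + s) * s"
    using assms by (intro mult_right_mono) auto
  also have "\<dots> = (r - s) * (s / (1 + s))"
    by simp
  also have "\<dots> \<le> r - s"
    using assms by (intro mult_left_le) auto
  finally show ?thesis .
qed

text \<open>Barycentric gluing, after Baudier and Lancien. Each \<open>F k\<close> expands only on the ball of radius
  \<open>exp (k + 1)\<close> about \<open>b\<close>, and is used on an annulus around radius \<open>exp k\<close>: the cut-off \<open>w k\<close> is a tent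
  function of \<open>a x = ln (1 + \<rho> x)\<close>, where \<open>\<rho> x\<close> is the distance to \<open>b\<close>. Measured logarithmically,
  the cut-off varies so slowly that
  multiplying it by \<open>G k\<close>, the translate of \<open>F k\<close> that vanishes at \<open>b\<close> and so has norm at most \<open>\<rho>\<close>, keeps the product Lipschitz. The map \<open>g\<close> is the
  \<open>\<ell>\<^sub>1\<close>-sum of the cut-off maps and of the radial coordinate \<open>\<rho>\<close>. At every point at most two cut-offs
  are nonzero, so at most \<open>5\<close> summands contribute to a distance, each at most \<open>2 * dist u v\<close>.

  For the lower bound, let \<open>x\<close> be the point further from \<open>b\<close> and \<open>k\<close> the integer nearest to \<open>a x\<close>, so
  that \<open>w k x\<close> is at least \<open>1/2\<close> and both points lie in the ball where \<open>F k\<close> expands. The loss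
  caused by \<open>w k x\<close> and \<open>w k y\<close> being different is at most \<open>\<rho> x - \<rho> y\<close>, which is exactly what the
  radial coordinate pays back.\<close>

lemma barycentric_gluing:
  fixes M :: "'a::metric_space set" and F :: "nat \<Rightarrow> 'a \<Rightarrow> L1_01"
  assumes b: "b \<in> M" and lip: "\<And>k. 1-lipschitz_on M (F k)"
    and expand: "\<And>k u v. u \<in> M \<Longrightarrow> v \<in> M \<Longrightarrow> dist b u \<le> exp (real k + 1) \<Longrightarrow>
      dist b v \<le> exp (real k + 1) \<Longrightarrow> n \<le> dist u v \<Longrightarrow> 2 * c \<le> norm (F k u - F k v)"
    and "0 \<le> c"
  shows "\<exists>g :: 'a \<Rightarrow> L1_01. \<forall>u\<in>M. \<forall>v\<in>M.
    norm (g u - g v) \<le> 10 * dist u v \<and> (n \<le> dist u v \<longrightarrow> c \<le> norm (g u - g v))"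
proof -
  define \<rho> where "\<rho> = dist b"
  define a where "a = (\<lambda>x. ln (1 + \<rho> x))"
  define w where "w = (\<lambda>(k::nat) x. max 0 (1 - \<bar>a x - real k\<bar>))"
  define G where "G = (\<lambda>k x. F k x - F k b)"
  obtain e :: L1_01 where e: "norm e = 1"
    using L1_unit_vector by blast
  define f where "f = (\<lambda>j x. case j of 0 \<Rightarrow> \<rho> x *\<^sub>R e | Suc k \<Rightarrow> w k x *\<^sub>R G k x)"
  define N where "N = (\<lambda>x. {nat \<lfloor>a x\<rfloor>, Suc (nat \<lfloor>a x\<rfloor>)})"
  have \<rho>_nonneg: "0 \<le> \<rho> x" for x
    by (simp add: \<rho>_def)
  have a_nonneg: "0 \<le> a x" for x
    using \<rho>_nonneg by (simp add: a_def)
  have w01: "0 \<le> w k x" "w k x \<le> 1" for k x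
    by (auto simp: w_def)
  have w_zero: "w k x = 0" if "k \<notin> N x" for k x
  proof (rule ccontr)
    assume "w k x \<noteq> 0"
    then have "\<bar>a x - real k\<bar> < 1"
      by (auto simp: w_def max_def split: if_splits)
    then have "\<lfloor>a x\<rfloor> = int k \<or> \<lfloor>a x\<rfloor> + 1 = int k"
      by linarith
    with a_nonneg[of x] that show False
      by (auto simp: N_def)
  qed
  have G_dist: "norm (G k x - G k y) \<le> dist x y" if "x \<in> M" "y \<in> M" for k x y
    using lipschitz_onD[OF lip that, of k] by (simp add: G_def dist_norm)
  have G_norm: "norm (G k x) \<le> \<rho> x" if "x \<in> M" for k x
    using lipschitz_onD[OF lip b that, of k] by (simp add: G_def \<rho>_def dist_norm norm_minus_commute)
  have w_slope: "\<bar>w k x - w k y\<bar> * norm (G k y) \<le> \<rho> x - \<rho> y"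
    if "x \<in> M" "y \<in> M" "\<rho> y \<le> \<rho> x" for k x y
  proof -
    have "\<bar>w k x - w k y\<bar> \<le> \<bar>a x - a y\<bar>"
      by (auto simp: w_def max_def)
    then have "\<bar>w k x - w k y\<bar> * norm (G k y) \<le> \<bar>a x - a y\<bar> * \<rho> y"
      using G_norm[OF that(2)] by (intro mult_mono) auto
    also have "\<dots> \<le> \<rho> x - \<rho> y"
      unfolding a_def using log_scale_slope \<rho>_nonneg that(3) .
    finally show ?thesis .
  qed
  have \<rho>_dist: "\<bar>\<rho> x - \<rho> y\<bar> \<le> dist x y" for x y
    unfolding \<rho>_def by (metis abs_dist_diff_le dist_commute)
  have split: "w k x *\<^sub>R G k x - w k y *\<^sub>R G k y =
      w k x *\<^sub>R (G k x - G k y) + (w k x - w k y) *\<^sub>R G k y" for k x y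
    by (simp add: algebra_simps)
  have f0: "norm (f 0 x - f 0 y) = \<bar>\<rho> x - \<rho> y\<bar>" for x y
    using e by (simp add: f_def flip: scaleR_diff_left)
  have term_le': "norm (f j x - f j y) \<le> 2 * dist x y"
    if "x \<in> M" "y \<in> M" "\<rho> y \<le> \<rho> x" for j x y
  proof (cases j)
    case 0
    then show ?thesis
      using f0 \<rho>_dist[of x y] by (smt (verit) zero_le_dist)
  next
    case (Suc k)
    have "norm (f j x - f j y) \<le> w k x * norm (G k x - G k y) + \<bar>w k x - w k y\<bar> * norm (G k y)"
      using norm_triangle_ineq[of "w k x *\<^sub>R (G k x - G k y)" "(w k x - w k y) *\<^sub>R G k y"] w01(1)[of k x]
      by (simp add: f_def Suc split)
    moreover have "w k x * norm (G k x - G k y) \<le> 1 * dist x y"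
      using w01 G_dist[OF that(1,2)] by (intro mult_mono) auto
    moreover have "\<bar>w k x - w k y\<bar> * norm (G k y) \<le> dist x y"
      using w_slope[OF that, of k] \<rho>_dist[of x y] by linarith
    ultimately show ?thesis by linarith
  qed
  have term_le: "norm (f j x - f j y) \<le> 2 * dist x y" if "x \<in> M" "y \<in> M" for j x y
    using term_le'[of x y j] term_le'[of y x j] that
    by (cases "\<rho> y \<le> \<rho> x") (auto simp: norm_minus_commute dist_commute)
  define J where "J = (\<lambda>x y. insert 0 (Suc ` (N x \<union> N y)))"
  have J: "finite (J x y)" "card (J x y) \<le> 5" for x y
    by (auto simp: J_def N_def card_insert_if)
  have f_zero: "norm (f j x - f j y) = 0" if "j \<notin> J x y" for j x y
  proof (cases j)
    case (Suc k)
    with that have "k \<notin> N x" "k \<notin> N y"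
      by (auto simp: J_def)
    then show ?thesis
      by (simp add: Suc f_def w_zero)
  qed (use that in \<open>simp add: J_def\<close>)
  have sums: "(\<lambda>j. norm (f j x - f j y)) sums (\<Sum>j\<in>J x y. norm (f j x - f j y))" for x y
    by (rule sums_finite[OF J(1) f_zero])
  have "\<exists>g :: 'a \<Rightarrow> L1_01. \<forall>x\<in>M. \<forall>y\<in>M. norm (g x - g y) = (\<Sum>j. norm (f j x - f j y))"
    by (rule l1_sum_in_L1) (rule sums_summable[OF sums])
  then obtain g :: "'a \<Rightarrow> L1_01"
    where g: "\<forall>x\<in>M. \<forall>y\<in>M. norm (g x - g y) = (\<Sum>j. norm (f j x - f j y))" ..
  have upper: "norm (g x - g y) \<le> 10 * dist x y" if "x \<in> M" "y \<in> M" for x y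
  proof -
    have "norm (g x - g y) = (\<Sum>j\<in>J x y. norm (f j x - f j y))"
      using g that sums_unique[OF sums] by metis
    also have "\<dots> \<le> (\<Sum>j\<in>J x y. 2 * dist x y)"
      using term_le[OF that] by (rule sum_mono)
    also have "\<dots> \<le> 5 * (2 * dist x y)"
      using mult_right_mono[of "real (card (J x y))" 5 "2 * dist x y"] J(2)[of x y] by simp
    finally show ?thesis by simp
  qed
  have lower': "c \<le> norm (g x - g y)" if xy: "x \<in> M" "y \<in> M" "\<rho> y \<le> \<rho> x" "n \<le> dist x y" for x y
  proof -
    define k where "k = nat (round (a x))"
    have "0 \<le> round (a x)"
      using round_mono[OF a_nonneg[of x]] by simp
    then have k: "\<bar>a x - real k\<bar> \<le> 1 / 2"
      using of_int_round_abs_le[of "a x"] by (simp add: k_def abs_minus_commute)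
    then have "a x \<le> real k + 1"
      by linarith
    then have "exp (a x) \<le> exp (real k + 1)"
      by simp
    then have "1 + \<rho> x \<le> exp (real k + 1)"
      using \<rho>_nonneg[of x] by (simp add: a_def add_pos_nonneg)
    with xy(3) have ball: "dist b x \<le> exp (real k + 1)" "dist b y \<le> exp (real k + 1)"
      unfolding \<rho>_def by auto
    have "2 * c \<le> norm (G k x - G k y)"
      using expand[OF xy(1,2) ball xy(4)] by (simp add: G_def)
    moreover have "1 / 2 \<le> w k x"
      using k by (simp add: w_def)
    ultimately have "1 / 2 * (2 * c) \<le> w k x * norm (G k x - G k y)"
      using \<open>0 \<le> c\<close> by (intro mult_mono) auto
    moreover have "w k x * norm (G k x - G k y) - \<bar>w k x - w k y\<bar> * norm (G k y) \<le> norm (f (Suc k) x - f (Suc k) y)"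
      using norm_diff_ineq[of "w k x *\<^sub>R (G k x - G k y)" "(w k x - w k y) *\<^sub>R G k y"] w01(1)[of k x]
      by (simp add: f_def split)
    moreover have "\<bar>w k x - w k y\<bar> * norm (G k y) \<le> norm (f 0 x - f 0 y)"
      using w_slope[OF xy(1-3), of k] by (simp add: f0)
    ultimately have "c \<le> (\<Sum>j\<in>{0, Suc k}. norm (f j x - f j y))"
      by simp
    also have "\<dots> \<le> norm (g x - g y)"
      using g xy(1,2) sum_le_suminf[OF sums_summable[OF sums[of x y]], of "{0, Suc k}"] by simp
    finally show ?thesis .
  qed
  have lower: "c \<le> norm (g x - g y)" if "x \<in> M" "y \<in> M" "n \<le> dist x y" for x y
    using lower'[of x y] lower'[of y x] that
    by (cases "\<rho> y \<le> \<rho> x") (auto simp: norm_minus_commute dist_commute)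
  show ?thesis
    using upper lower by blast
qed

section \<open>Coarse embeddings from expanding maps\<close>

text \<open>The best lower control function is the infimum of the distances between images of points at
  distance at least \<open>r\<close>. Adjoining \<open>r\<close> itself to the set keeps it nonempty when \<open>M\<close> is bounded
  and does not spoil divergence.\<close>

lemma coarse_embedding_onI:
  fixes M :: "'a::metric_space set" and f :: "'a \<Rightarrow> 'b::metric_space"
  assumes upper: "\<And>x y. x \<in> M \<Longrightarrow> y \<in> M \<Longrightarrow> dist (f x) (f y) \<le> L * dist x y"
    and "0 \<le> L"
    and lower: "\<And>c. \<exists>r. \<forall>x\<in>M. \<forall>y\<in>M. r \<le> dist x y \<longrightarrow> c \<le> dist (f x) (f y)"
  shows "coarse_embedding_on M f"
proof -
  define S where "S = (\<lambda>r. insert r {dist (f x) (f y) | x y. x \<in> M \<and> y \<in> M \<and> r \<le> dist x y})"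
  have S_nonneg: "0 \<le> s" if "0 \<le> r" "s \<in> S r" for r s
    using that by (auto simp: S_def)
  have bdd: "bdd_below (S r)" if "0 \<le> r" for r
    using S_nonneg[OF that] by (rule bdd_belowI)
  have nonempty: "S r \<noteq> {}" for r
    by (simp add: S_def)
  have "filterlim (\<lambda>r. Inf (S r)) at_top at_top"
    unfolding filterlim_at_top
  proof
    fix c
    obtain r where r: "\<forall>x\<in>M. \<forall>y\<in>M. r \<le> dist x y \<longrightarrow> c \<le> dist (f x) (f y)"
      using lower by blast
    have "c \<le> Inf (S t)" if "max r c \<le> t" for t
      using r that by (intro cInf_greatest[OF nonempty]) (force simp: S_def)
    then show "\<forall>\<^sub>F t in at_top. c \<le> Inf (S t)"
      unfolding eventually_at_top_linorder by blast
  qed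
  moreover have "Inf (S (dist x y)) \<le> dist (f x) (f y)" if "x \<in> M" "y \<in> M" for x y
    using that by (intro cInf_lower[OF _ bdd]) (auto simp: S_def)
  moreover have "0 \<le> Inf (S r)" if "0 \<le> r" for r
    using S_nonneg[OF that] by (intro cInf_greatest[OF nonempty])
  ultimately show ?thesis
    unfolding coarse_embedding_on_def
    using upper \<open>0 \<le> L\<close>
    by (intro exI[of _ "\<lambda>r. Inf (S r)"] exI[of _ "\<lambda>r. L * r"]) auto
qed

text \<open>With \<open>g j\<close> expanding distant pairs to \<open>4 ^ j\<close> and weights \<open>1 / 2 ^ j\<close>, the \<open>\<ell>\<^sub>1\<close>-sum is still
  Lipschitz, and its \<open>j\<close>-th summand alone separates pairs at distance \<open>n j\<close> by \<open>2 ^ j\<close>.\<close>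

lemma coarse_embedding_of_expansions:
  fixes M :: "'a::metric_space set"
  assumes "\<And>c. 0 \<le> c \<Longrightarrow> \<exists>n. \<exists>g :: 'a \<Rightarrow> L1_01. \<forall>u\<in>M. \<forall>v\<in>M.
    norm (g u - g v) \<le> L * dist u v \<and> (n \<le> dist u v \<longrightarrow> c \<le> norm (g u - g v))"
    and "0 \<le> L"
  shows "\<exists>f :: 'a \<Rightarrow> L1_01. coarse_embedding_on M f"
proof -
  have "\<forall>j. \<exists>n. \<exists>g :: 'a \<Rightarrow> L1_01. \<forall>u\<in>M. \<forall>v\<in>M.
    norm (g u - g v) \<le> L * dist u v \<and> (n \<le> dist u v \<longrightarrow> 4 ^ j \<le> norm (g u - g v))"
    by (intro allI assms(1)) simp
  then obtain n and g :: "nat \<Rightarrow> 'a \<Rightarrow> L1_01" where g: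
    "\<And>j u v. u \<in> M \<Longrightarrow> v \<in> M \<Longrightarrow> norm (g j u - g j v) \<le> L * dist u v"
    "\<And>j u v. u \<in> M \<Longrightarrow> v \<in> M \<Longrightarrow> n j \<le> dist u v \<Longrightarrow> 4 ^ j \<le> norm (g j u - g j v)"
    by metis
  define h where "h = (\<lambda>j x. (1 / 2) ^ j *\<^sub>R g j x)"
  have h: "norm (h j u - h j v) = (1 / 2) ^ j * norm (g j u - g j v)" for j u v
    by (simp add: h_def flip: scaleR_diff_right)
  have h_le: "norm (h j u - h j v) \<le> (1 / 2) ^ j * (L * dist u v)" if "u \<in> M" "v \<in> M" for j u v
    unfolding h using g(1)[OF that] by (intro mult_left_mono) auto
  have geometric: "(\<lambda>j. (1 / 2) ^ j * (L * dist u v)) sums (2 * (L * dist u v))" for u v :: 'a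
    using sums_mult2[OF geometric_sums[of "1 / 2 :: real"]] by simp
  have summable: "summable (\<lambda>j. norm (h j u - h j v))" if "u \<in> M" "v \<in> M" for u v
    by (rule summable_comparison_test'[OF sums_summable[OF geometric]]) (use h_le[OF that] in simp)
  have "\<exists>f :: 'a \<Rightarrow> L1_01. \<forall>u\<in>M. \<forall>v\<in>M. norm (f u - f v) = (\<Sum>j. norm (h j u - h j v))"
    by (rule l1_sum_in_L1) (rule summable)
  then obtain f :: "'a \<Rightarrow> L1_01"
    where f: "\<forall>u\<in>M. \<forall>v\<in>M. norm (f u - f v) = (\<Sum>j. norm (h j u - h j v))" ..
  have "coarse_embedding_on M f"
  proof (rule coarse_embedding_onI)
    fix u v assume uv: "u \<in> M" "v \<in> M"
    have "(\<Sum>j. norm (h j u - h j v)) \<le> (\<Sum>j. (1 / 2) ^ j * (L * dist u v))"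
      by (rule suminf_le[OF h_le[OF uv] summable[OF uv] sums_summable[OF geometric]])
    also have "\<dots> = 2 * (L * dist u v)"
      by (rule sums_unique[OF geometric, symmetric])
    finally show "dist (f u) (f v) \<le> 2 * L * dist u v"
      using f uv by (simp add: dist_norm)
  next
    fix c :: real
    obtain j where j: "c < 2 ^ j"
      using real_arch_pow[of 2 c] by auto
    have "c \<le> dist (f u) (f v)" if uv: "u \<in> M" "v \<in> M" and "n j \<le> dist u v" for u v
    proof -
      have "(2::real) ^ j = (1 / 2) ^ j * 4 ^ j"
        by (simp flip: power_mult_distrib)
      also have "\<dots> \<le> norm (h j u - h j v)"
        unfolding h using g(2)[OF that] by (intro mult_left_mono) auto
      also have "\<dots> \<le> (\<Sum>j. norm (h j u - h j v))"
        using sum_le_suminf[OF summable[OF uv], of "{j}"] by simp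
      finally show ?thesis
        using j f uv by (simp add: dist_norm)
    qed
    then show "\<exists>r. \<forall>x\<in>M. \<forall>y\<in>M. r \<le> dist x y \<longrightarrow> c \<le> dist (f x) (f y)"
      by blast
  qed (use \<open>0 \<le> L\<close> in simp)
  then show ?thesis by blast
qed


section \<open>Measures that no Lipschitz map into \<open>L\<^sub>1\<close> expands on average\<close>

lemma Lip_const_greatest:
  assumes "L-lipschitz_on M f" and "\<And>K. 0 < K \<Longrightarrow> K-lipschitz_on M f \<Longrightarrow> a \<le> K"
  shows "a \<le> Lip_const M f"
  unfolding Lip_const_def
proof (rule cInf_greatest)
  have "(L + 1)-lipschitz_on M f"
    using assms(1) by (rule lipschitz_on_le) simp
  then show "{L. 0 < L \<and> L-lipschitz_on M f} \<noteq> {}"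
    using lipschitz_on_nonneg[OF assms(1)] by (auto intro!: exI[of _ "L + 1"])
qed (use assms(2) in auto)

lemma Lip_const_nonneg:
  assumes "L-lipschitz_on M f"
  shows "0 \<le> Lip_const M f"
  using assms by (rule Lip_const_greatest) simp

lemma dist_le_Lip_const:
  assumes "L-lipschitz_on M f" "x \<in> M" "y \<in> M"
  shows "dist (f x) (f y) \<le> Lip_const M f * dist x y"
proof (cases "dist x y = 0")
  case True
  then show ?thesis
    using lipschitz_onD[OF assms] by simp
next
  case False
  then have pos: "0 < dist x y"
    by (metis zero_le_dist less_le)
  have "dist (f x) (f y) / dist x y \<le> Lip_const M f"
    using assms(1)
  proof (rule Lip_const_greatest)
    fix K assume "K-lipschitz_on M f"
    then show "dist (f x) (f y) / dist x y \<le> K"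
      using lipschitz_onD[OF _ assms(2,3), of K f] pos by (simp add: pos_divide_le_eq)
  qed
  then show ?thesis
    using pos by (simp add: pos_divide_le_eq)
qed

text \<open>If no measure works for \<open>D\<close> and \<open>n\<close>, then in particular the one with weights \<open>a\<close> fails, and a map
  that witnesses this has a positive Lipschitz constant, by which it can be divided.\<close>

lemma average_expansion:
  fixes M :: "'a::metric_space set" and D n :: real
  assumes no_measure: "\<not> (\<exists>(B :: ('a \<times> 'a) set) \<mu>.
      finite B \<and> B \<subseteq> M \<times> M \<and> prob_space \<mu> \<and> space \<mu> = B \<and> sets \<mu> = Pow B \<and>
      (\<forall>(u, v)\<in>B. n \<le> dist u v) \<and>
      (\<forall>f :: 'a \<Rightarrow> L1_01. (\<exists>L. L-lipschitz_on M f) \<longrightarrow>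
         (\<integral>(u, v). norm (f u - f v) \<partial>\<mu>) \<le> D * Lip_const M f))"
    and "0 \<le> D"
    and B: "finite B" "B \<subseteq> M \<times> M" "\<forall>(u, v)\<in>B. n \<le> dist u v"
    and weights: "\<forall>p\<in>B. 0 \<le> a p" "sum a B = 1"
  shows "\<exists>f :: 'a \<Rightarrow> L1_01. 1-lipschitz_on M f \<and> D \<le> (\<Sum>p\<in>B. a p * norm (f (fst p) - f (snd p)))"
proof -
  define \<mu> where "\<mu> = point_measure B (\<lambda>p. ennreal (a p))"
  have "emeasure \<mu> B = 1"
    using B(1) weights by (simp add: \<mu>_def emeasure_point_measure_finite sum_ennreal)
  then have "prob_space \<mu>"
    by (intro prob_spaceI) (simp add: \<mu>_def space_point_measure)
  moreover have "space \<mu> = B" "sets \<mu> = Pow B"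
    by (simp_all add: \<mu>_def space_point_measure sets_point_measure)
  ultimately have "\<not> (\<forall>f :: 'a \<Rightarrow> L1_01. (\<exists>L. L-lipschitz_on M f) \<longrightarrow>
      (\<integral>(u, v). norm (f u - f v) \<partial>\<mu>) \<le> D * Lip_const M f)"
    using no_measure[unfolded not_ex, rule_format, of B \<mu>] B by blast
  then obtain f :: "'a \<Rightarrow> L1_01" and L where f: "L-lipschitz_on M f"
    and large: "D * Lip_const M f < (\<integral>(u, v). norm (f u - f v) \<partial>\<mu>)"
    by (auto simp: not_le)
  define l where "l = Lip_const M f"
  define I where "I = (\<lambda>f :: 'a \<Rightarrow> L1_01. \<Sum>p\<in>B. a p * norm (f (fst p) - f (snd p)))"
  have "(\<integral>(u, v). norm (f u - f v) \<partial>\<mu>) = I f"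
    using B(1) weights
    by (simp add: \<mu>_def I_def lebesgue_integral_point_measure_finite case_prod_beta)
  with large have If: "D * l < I f"
    by (simp add: l_def)
  have dist_le: "norm (f u - f v) \<le> l * dist u v" if "u \<in> M" "v \<in> M" for u v
    using dist_le_Lip_const[OF f that] by (simp add: dist_norm l_def)
  have "0 \<le> l"
    unfolding l_def by (rule Lip_const_nonneg[OF f])
  moreover have "l \<noteq> 0"
  proof
    assume "l = 0"
    then have "I f = 0"
      unfolding I_def using dist_le B(2) by (intro sum.neutral) fastforce
    with If \<open>l = 0\<close> show False by simp
  qed
  ultimately have "0 < l" by simp
  define g where "g = (\<lambda>x. (1 / l) *\<^sub>R f x)"
  have g: "norm (g u - g v) = norm (f u - f v) / l" for u v
    using \<open>0 < l\<close> by (simp add: g_def flip: scaleR_diff_right)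
  have "1-lipschitz_on M g"
    using dist_le \<open>0 < l\<close> by (intro lipschitz_onI) (auto simp: dist_norm g pos_divide_le_eq mult.commute)
  moreover have "I g = I f / l"
    by (simp add: I_def g sum_divide_distrib)
  then have "D \<le> I g"
    using If \<open>0 < l\<close> by (simp add: pos_le_divide_eq)
  ultimately show ?thesis
    unfolding I_def by blast
qed

theorem theorem2p4:
  fixes M :: "'a::metric_space set"
  assumes "locally_finite_metric M"
    and "\<not> (\<exists>f :: 'a \<Rightarrow> L1_01. coarse_embedding_on M f)"
  shows "\<exists>D :: real. \<forall>n :: nat. \<exists>(B :: ('a \<times> 'a) set) (\<mu> :: ('a \<times> 'a) measure).
           finite B \<and> B \<subseteq> M \<times> M \<and>
           prob_space \<mu> \<and> space \<mu> = B \<and> sets \<mu> = Pow B \<and>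
           (\<forall>(u, v)\<in>B. real n \<le> dist u v) \<and>
           (\<forall>f :: 'a \<Rightarrow> L1_01. (\<exists>L. L-lipschitz_on M f) \<longrightarrow>
              (\<integral>(u, v). norm (f u - f v) \<partial>\<mu>) \<le> D * Lip_const M f)"
    (is "\<exists>D. \<forall>n. ?measure_exists D n")
proof (rule ccontr)
  assume neg: "\<not> ?thesis"
  have "\<exists>f :: 'a \<Rightarrow> L1_01. coarse_embedding_on M f"
  proof (rule coarse_embedding_of_expansions)
    fix c :: real assume "0 \<le> c"
    show "\<exists>n. \<exists>g :: 'a \<Rightarrow> L1_01. \<forall>u\<in>M. \<forall>v\<in>M.
      norm (g u - g v) \<le> 10 * dist u v \<and> (n \<le> dist u v \<longrightarrow> c \<le> norm (g u - g v))"
    proof (cases "M = {}")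
      case True
      then show ?thesis by simp
    next
      case False
      then obtain b where b: "b \<in> M" by blast
      \<comment> \<open>The gluing halves the expansion and the minimax principle loses an error, here \<open>1\<close>.\<close>
      obtain n where n: "\<not> ?measure_exists (2 * c + 1) n"
        using neg by blast
      define B where "B = (\<lambda>k::nat. {(u, v). u \<in> M \<inter> cball b (exp (real k + 1)) \<and>
        v \<in> M \<inter> cball b (exp (real k + 1)) \<and> real n \<le> dist u v})"
      have "\<exists>f :: 'a \<Rightarrow> L1_01. 1-lipschitz_on M f \<and> (\<forall>(u, v)\<in>B k. 2 * c \<le> norm (f u - f v))" for k
      proof -
        let ?ball = "M \<inter> cball b (exp (real k + 1))"
        have "finite ?ball"
          using assms(1) b unfolding locally_finite_metric_def by blast
        then have "finite (?ball \<times> ?ball)"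
          by simp
        then have "finite (B k)"
          by (rule rev_finite_subset) (auto simp: B_def)
        moreover have "B k \<subseteq> M \<times> M" "\<forall>(u, v)\<in>B k. real n \<le> dist u v"
          by (auto simp: B_def)
        ultimately have "\<exists>f :: 'a \<Rightarrow> L1_01. 1-lipschitz_on M f \<and>
            (\<forall>(u, v)\<in>B k. (2 * c + 1) - 1 \<le> norm (f u - f v))"
          using \<open>0 \<le> c\<close> by (intro expansion_on_finite_set average_expansion[OF n]) auto
        then show ?thesis by simp
      qed
      then obtain F :: "nat \<Rightarrow> 'a \<Rightarrow> L1_01" where F: "\<And>k. 1-lipschitz_on M (F k)"
        "\<And>k. \<forall>(u, v)\<in>B k. 2 * c \<le> norm (F k u - F k v)"
        by metis
      have "\<exists>g :: 'a \<Rightarrow> L1_01. \<forall>u\<in>M. \<forall>v\<in>M.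
        norm (g u - g v) \<le> 10 * dist u v \<and> (real n \<le> dist u v \<longrightarrow> c \<le> norm (g u - g v))"
        by (rule barycentric_gluing[OF b F(1) _ \<open>0 \<le> c\<close>]) (use F(2) in \<open>auto simp: B_def\<close>)
      then show ?thesis by blast
    qed
  qed simp
  with assms(2) show False by blast
qed

end
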